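(* Let $\mathbb{N}=(N,+,\cdot,\dot{-},\mathsf s,0,1)$ be the bag semiring of natural numbers expanded with truncated subtraction $\dot{-}$ as monus and with support $\mathsf s$. Then no expression of basic relational algebra $\mathcal{BRA}$ defines the division operation $\div$ on $\mathbb N$-databases; that is, division is not expressible using union, difference, Cartesian product, projection, selection, and support on $\mathbb N$-databases. Precisely: there are arities $n_1>n_2\geq 1$ such that, for the schema $\tau=(\hat R,\hat S)$ with $\hat R$ of arity $n_1$ and $\hat S$ of arity $n_2$, there is no $\mathcal{BRA}(\tau)$-expression $E$ of arity $n_1-n_2$ satisfying $E^{\mathbf I}=R\div S$ for every $\mathbb N$-database $\mathbf I=(R,S)$ over $\tau$.
   Context: **Bag semiring.** $N$ is the set of natural numbers (including $0$) with usual $+,\cdot$; $a\,\dot{-}\,b=a-b$ if $a\ge b$ and $0$ otherwise; $\mathsf s(a)=1$ if $a\ne 0$ and $\mathsf s(0)=0$. **$\mathbb N$-relations.** $D$ is a fixed denumerable set; $D^0=\{\langle\,\rangle\}$ consists of the empty tuple. An $n$-ary $\mathbb N$-relation (bag) ($n\ge0$) is a function $R:D^n\to N$ with $\operatorname{supp}(R)=\{\mathbf t: R(\mathbf t)\neq 0\}$ finite. For $\mathbf t=(d_1,\dots,d_n)$ and a sequence $v=(i_1,\dots,i_k)$ of distinct indices in $\{1,\dots,n\}$, $\mathbf t[v]=(d_{i_1},\dots,d_{i_k})$. An $n$-ary selection condition $\theta$ is built from equalities $x_i=x_j$ and negated equalities $x_i\ne x_j$ ($1\le i,j\le n$) by conjunctions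 and disjunctions; $P_\theta:D^n\to\{0,1\}$ is $1$ exactly on tuples satisfying $\theta$. **Operations.** - Union (same arity): $(R_1\cup R_2)(\mathbf t)=R_1(\mathbf t)+R_2(\mathbf t)$. - Difference (same arity): $(R_1\setminus R_2)(\mathbf t)=R_1(\mathbf t)\,\dot{-}\,R_2(\mathbf t)$. - Cartesian product of an $m$-ary $R_1$ and an $n$-ary $R_2$: the $(m+n)$-ary $(R_1\times R_2)(\mathbf t)=R_1(t_1,\dots,t_m)\cdot R_2(t_{m+1},\dots,t_{m+n})$. - Projection, for $R$ $n$-ary and $v$ a sequence of $k$ distinct indices from $\{1,\dots,n\}$: $\pi_v(R)(\mathbf t)=\sum_{\mathbf w[v]=\mathbf t,\ R(\mathbf w)\ne0}R(\mathbf w)$ for $\mathbf t\in D^k$; projection on the empty sequence: $\pi_{[\,]}(R)(\langle\,\rangle)=\sum_{R(\mathbf t)\neq0}R(\mathbf t)$. - Selection: $\sigma_\theta(R)(\mathbf t)=R(\mathbf t)\cdot P_\theta(\mathbf t)$. - Support: $\operatorname{supp}(R)(\mathbf t)=\mathsf s(R(\mathbf t))$. **Division.** For $R_1:D^{n_1}\to N$ and $R_2:D^{n_2}\to N$ with $n_1>n_2$, $R_1\div R_2:D^{n_1-n_2}\to N$ is $$(R_1\div R_2)(\mathbf a)=\mathsf s\Big(\sum_{\mathbf b\in D^{n_2}}R_1(\mathbf a,\mathbf b)\Big)\cdot\prod_{\mathbf b:\,R_2(\mathbf b)\ne 0}R_1(\mathbf a,\mathbf b),$$ with the empty product equal to $1$.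 **Expressions and databases.** A schema $\tau$ is a finite sequence of relation symbols of positive arities. $\mathcal{BRA}(\tau)$-expressions are built from the relation symbols of $\tau$ by $\cup$, $\setminus$ (same arities), $\times$, $\pi_v$, $\pi_{[\,]}$, $\sigma_\theta$, $\operatorname{supp}$, with the evident arities. An $\mathbb N$-database $\mathbf I$ over $\tau$ assigns to each relation symbol an $\mathbb N$-relation of the same arity; databases are assumed non-trivial, i.e. at least one of the relations has non-empty support. $E^{\mathbf I}$ is the $\mathbb N$-relation obtained by evaluating $E$ on $\mathbf I$. *)

theory Defs
  imports Main "HOL-Library.Countable_Set"
begin

text \<open>
  Tuples over the domain are lists, and an $n$-ary bag relation is a function on all lists that
  vanishes at every list whose length is not $n$.  So two $n$-ary bag relations are equal as
  functions on lists iff they agree on all $n$-tuples.  Positions in tuples and relation symbols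
  of a schema are numbered from \<open>0\<close>, as usual for lists.
\<close>

type_synonym 'd nrel = "'d list \<Rightarrow> nat"

definition is_nrel :: "nat \<Rightarrow> 'd nrel \<Rightarrow> bool" where
  "is_nrel n R \<longleftrightarrow> finite {t. R t \<noteq> 0} \<and> (\<forall>t. R t \<noteq> 0 \<longrightarrow> length t = n)"

text \<open>The monus of the bag semiring is subtraction on \<^typ>\<open>nat\<close>, which is truncated.\<close>

definition bag_supp :: "nat \<Rightarrow> nat" where
  "bag_supp a = (if a \<noteq> 0 then 1 else 0)"

datatype cond =
    CEq nat nat
  | CNeq nat nat
  | CAnd cond cond
  | COr cond cond

primrec wf_cond :: "nat \<Rightarrow> cond \<Rightarrow> bool" where
  "wf_cond n (CEq i j) \<longleftrightarrow> i < n \<and> j < n"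
| "wf_cond n (CNeq i j) \<longleftrightarrow> i < n \<and> j < n"
| "wf_cond n (CAnd c d) \<longleftrightarrow> wf_cond n c \<and> wf_cond n d"
| "wf_cond n (COr c d) \<longleftrightarrow> wf_cond n c \<and> wf_cond n d"

primrec sat :: "cond \<Rightarrow> 'd list \<Rightarrow> bool" where
  "sat (CEq i j) t \<longleftrightarrow> t ! i = t ! j"
| "sat (CNeq i j) t \<longleftrightarrow> t ! i \<noteq> t ! j"
| "sat (CAnd c d) t \<longleftrightarrow> sat c t \<and> sat d t"
| "sat (COr c d) t \<longleftrightarrow> sat c t \<or> sat d t"

definition nrel_union :: "'d nrel \<Rightarrow> 'd nrel \<Rightarrow> 'd nrel" where
  "nrel_union R1 R2 t = R1 t + R2 t"

definition nrel_diff :: "'d nrel \<Rightarrow> 'd nrel \<Rightarrow> 'd nrel" where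
  "nrel_diff R1 R2 t = R1 t - R2 t"

text \<open>The parameter \<open>m\<close> is the arity of the first factor.\<close>

definition nrel_times :: "nat \<Rightarrow> 'd nrel \<Rightarrow> 'd nrel \<Rightarrow> 'd nrel" where
  "nrel_times m R1 R2 t = R1 (take m t) * R2 (drop m t)"

text \<open>For \<open>v = []\<close> this is the projection on the empty sequence.\<close>

definition nrel_proj :: "nat list \<Rightarrow> 'd nrel \<Rightarrow> 'd nrel" where
  "nrel_proj v R t = (\<Sum>w | map (\<lambda>i. w ! i) v = t \<and> R w \<noteq> 0. R w)"

definition nrel_sel :: "cond \<Rightarrow> 'd nrel \<Rightarrow> 'd nrel" where
  "nrel_sel c R t = R t * (if sat c t then 1 else 0)"

definition nrel_supp :: "'d nrel \<Rightarrow> 'd nrel" where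
  "nrel_supp R t = bag_supp (R t)"

text \<open>
  The sum over all $n_2$-tuples is restricted to its nonzero terms, because a \<^const>\<open>sum\<close> over an
  infinite index set is \<open>0\<close> by convention.
\<close>

definition nrel_division :: "nat \<Rightarrow> nat \<Rightarrow> 'd nrel \<Rightarrow> 'd nrel \<Rightarrow> 'd nrel" where
  "nrel_division n1 n2 R1 R2 a =
     (if length a = n1 - n2
      then bag_supp (\<Sum>b | length b = n2 \<and> R1 (a @ b) \<noteq> 0. R1 (a @ b))
             * (\<Prod>b | R2 b \<noteq> 0. R1 (a @ b))
      else 0)"

text \<open>
  A schema is the list of the arities of its relation symbols; \<open>Rel i\<close> is its \<open>i\<close>-th symbol.
\<close>

datatype bra =
    Rel nat
  | Cup bra bra
  | Diff bra bra
  | Times bra bra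
  | Proj "nat list" bra
  | Sel cond bra
  | Supp bra

primrec arity :: "nat list \<Rightarrow> bra \<Rightarrow> nat" where
  "arity \<tau> (Rel i) = \<tau> ! i"
| "arity \<tau> (Cup E F) = arity \<tau> E"
| "arity \<tau> (Diff E F) = arity \<tau> E"
| "arity \<tau> (Times E F) = arity \<tau> E + arity \<tau> F"
| "arity \<tau> (Proj v E) = length v"
| "arity \<tau> (Sel c E) = arity \<tau> E"
| "arity \<tau> (Supp E) = arity \<tau> E"

primrec wf_bra :: "nat list \<Rightarrow> bra \<Rightarrow> bool" where
  "wf_bra \<tau> (Rel i) \<longleftrightarrow> i < length \<tau>"
| "wf_bra \<tau> (Cup E F) \<longleftrightarrow> wf_bra \<tau> E \<and> wf_bra \<tau> F \<and> arity \<tau> E = arity \<tau> F"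
| "wf_bra \<tau> (Diff E F) \<longleftrightarrow> wf_bra \<tau> E \<and> wf_bra \<tau> F \<and> arity \<tau> E = arity \<tau> F"
| "wf_bra \<tau> (Times E F) \<longleftrightarrow> wf_bra \<tau> E \<and> wf_bra \<tau> F"
| "wf_bra \<tau> (Proj v E) \<longleftrightarrow> wf_bra \<tau> E \<and> distinct v \<and> (\<forall>i\<in>set v. i < arity \<tau> E)"
| "wf_bra \<tau> (Sel c E) \<longleftrightarrow> wf_bra \<tau> E \<and> wf_cond (arity \<tau> E) c"
| "wf_bra \<tau> (Supp E) \<longleftrightarrow> wf_bra \<tau> E"

definition is_database :: "nat list \<Rightarrow> 'd nrel list \<Rightarrow> bool" where
  "is_database \<tau> I \<longleftrightarrow> list_all2 is_nrel \<tau> I \<and> (\<exists>R\<in>set I. {t. R t \<noteq> 0} \<noteq> {})"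

primrec eval_bra :: "nat list \<Rightarrow> 'd nrel list \<Rightarrow> bra \<Rightarrow> 'd nrel" where
  "eval_bra \<tau> I (Rel i) = I ! i"
| "eval_bra \<tau> I (Cup E F) = nrel_union (eval_bra \<tau> I E) (eval_bra \<tau> I F)"
| "eval_bra \<tau> I (Diff E F) = nrel_diff (eval_bra \<tau> I E) (eval_bra \<tau> I F)"
| "eval_bra \<tau> I (Times E F) = nrel_times (arity \<tau> E) (eval_bra \<tau> I E) (eval_bra \<tau> I F)"
| "eval_bra \<tau> I (Proj v E) = nrel_proj v (eval_bra \<tau> I E)"
| "eval_bra \<tau> I (Sel c E) = nrel_sel c (eval_bra \<tau> I E)"
| "eval_bra \<tau> I (Supp E) = nrel_supp (eval_bra \<tau> I E)"

lemma is_nrel_subset: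
  assumes "is_nrel n R" "\<And>t. R' t \<noteq> 0 \<Longrightarrow> R t \<noteq> 0"
  shows "is_nrel n R'"
proof -
  have "{t. R' t \<noteq> 0} \<subseteq> {t. R t \<noteq> 0}" using assms(2) by blast
  then have "finite {t. R' t \<noteq> 0}" using assms(1) finite_subset unfolding is_nrel_def by blast
  then show ?thesis using assms unfolding is_nrel_def by blast
qed

lemma is_nrel_union:
  assumes "is_nrel n R1" "is_nrel n R2"
  shows "is_nrel n (nrel_union R1 R2)"
proof -
  have "{t. nrel_union R1 R2 t \<noteq> 0} \<subseteq> {t. R1 t \<noteq> 0} \<union> {t. R2 t \<noteq> 0}"
    by (auto simp: nrel_union_def)
  then show ?thesis
    using assms finite_subset[OF _ finite_UnI] unfolding is_nrel_def by blast
qed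

lemma is_nrel_times:
  assumes "is_nrel m R1" "is_nrel n R2"
  shows "is_nrel (m + n) (nrel_times m R1 R2)"
proof -
  let ?A = "{t. R1 t \<noteq> 0}" and ?B = "{t. R2 t \<noteq> 0}"
  have "t \<in> (\<lambda>(a, b). a @ b) ` (?A \<times> ?B)" if "nrel_times m R1 R2 t \<noteq> 0" for t
    using that by (auto simp: nrel_times_def intro!: image_eqI[of _ _ "(take m t, drop m t)"])
  then have "{t. nrel_times m R1 R2 t \<noteq> 0} \<subseteq> (\<lambda>(a, b). a @ b) ` (?A \<times> ?B)" by blast
  moreover have "finite ((\<lambda>(a, b). a @ b) ` (?A \<times> ?B))"
    using assms by (auto simp: is_nrel_def)
  moreover have "length t = m + n" if "nrel_times m R1 R2 t \<noteq> 0" for t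
  proof -
    have "length (take m t) = m" "length (drop m t) = n"
      using that assms by (auto simp only: nrel_times_def is_nrel_def mult_eq_0_iff)
    then have "length (take m t @ drop m t) = m + n" by (simp only: length_append)
    then show ?thesis by simp
  qed
  ultimately show ?thesis unfolding is_nrel_def using finite_subset by blast
qed

lemma is_nrel_proj:
  assumes "is_nrel n R"
  shows "is_nrel (length v) (nrel_proj v R)"
proof -
  have ex: "\<exists>w. map (\<lambda>i. w ! i) v = t \<and> R w \<noteq> 0" if "nrel_proj v R t \<noteq> 0" for t
    using sum.not_neutral_contains_not_neutral[OF that[unfolded nrel_proj_def]] by blast
  then have "{t. nrel_proj v R t \<noteq> 0} \<subseteq> (\<lambda>w. map (\<lambda>i. w ! i) v) ` {w. R w \<noteq> 0}" by fast
  moreover have "length t = length v" if "nrel_proj v R t \<noteq> 0" for t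
    using ex[OF that] by auto
  ultimately show ?thesis
    using assms finite_surj unfolding is_nrel_def by blast
qed

lemma is_nrel_eval_bra:
  assumes "is_database \<tau> I" "wf_bra \<tau> E"
  shows "is_nrel (arity \<tau> E) (eval_bra \<tau> I E)"
  using assms(2)
proof (induction E)
  case (Rel i)
  then show ?case using assms(1) by (auto simp: is_database_def list_all2_conv_all_nth)
next
  case (Diff E F)
  then show ?case
    by (auto intro!: is_nrel_subset[where R = "eval_bra \<tau> I E"] simp: nrel_diff_def)
next
  case (Sel c E)
  then show ?case by (auto intro!: is_nrel_subset[where R = "eval_bra \<tau> I E"] simp: nrel_sel_def)
next
  case (Supp E)
  then show ?case
    by (auto intro!: is_nrel_subset[where R = "eval_bra \<tau> I E"]
        simp: nrel_supp_def bag_supp_def split: if_splits)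
qed (auto simp: is_nrel_union is_nrel_times is_nrel_proj)

lemma is_nrel_division:
  assumes "is_nrel n1 R1"
  shows "is_nrel (n1 - n2) (nrel_division n1 n2 R1 R2)"
proof -
  have "a \<in> take (n1 - n2) ` {t. R1 t \<noteq> 0}" if "nrel_division n1 n2 R1 R2 a \<noteq> 0" for a
  proof -
    have len: "length a = n1 - n2"
      using that by (auto simp: nrel_division_def split: if_splits)
    have "(\<Sum>b | length b = n2 \<and> R1 (a @ b) \<noteq> 0. R1 (a @ b)) \<noteq> 0"
    proof
      assume "(\<Sum>b | length b = n2 \<and> R1 (a @ b) \<noteq> 0. R1 (a @ b)) = 0"
      then have "nrel_division n1 n2 R1 R2 a = 0"
        by (simp only: nrel_division_def bag_supp_def mult_zero_left if_cancel simp_thms if_False)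
      with that show False by blast
    qed
    then obtain b where "R1 (a @ b) \<noteq> 0"
      by (rule sum.not_neutral_contains_not_neutral) auto
    then show ?thesis using len by (auto intro!: image_eqI[of _ _ "a @ b"])
  qed
  then have "{a. nrel_division n1 n2 R1 R2 a \<noteq> 0} \<subseteq> take (n1 - n2) ` {t. R1 t \<noteq> 0}" by blast
  moreover have "length a = n1 - n2" if "nrel_division n1 n2 R1 R2 a \<noteq> 0" for a
    using that by (auto simp: nrel_division_def split: if_splits)
  ultimately show ?thesis
    using assms finite_surj unfolding is_nrel_def by blast
qed

end

(*
  The total multiplicity of the value of a fixed expression is bounded by a polynomial in the total
  multiplicity of the database: union adds totals, product multiplies them, projection preserves
  them, and the other operations do not increase them.  Division is not polynomially bounded:
  if R contains each of (a, b_1), ..., (a, b_k) twice and S contains each b_i once, then a has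
  multiplicity 2^k in the quotient of R by S, while R and S each have total multiplicity at most 2k.
*)
theory Submission
  imports Defs
begin

text \<open>The sum runs over the support because \<open>sum\<close> over the infinite set of all
  lists would be 0 by convention.\<close>

definition total :: "'d nrel \<Rightarrow> nat" where
  "total R = (\<Sum>t | R t \<noteq> 0. R t)"

lemma is_nrel_finite: "is_nrel n R \<Longrightarrow> finite {t. R t \<noteq> 0}"
  by (simp add: is_nrel_def)

text \<open>Zero terms contribute nothing, so totals of several relations can be compared as sums
  over one common finite index set.\<close>

lemma total_eq_sum:
  assumes "finite A" "{t. R t \<noteq> 0} \<subseteq> A"
  shows "total R = (\<Sum>t\<in>A. R t)"
  unfolding total_def by (rule sum.mono_neutral_left) (use assms in auto)

lemma le_total:
  assumes "finite {t. R t \<noteq> 0}"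
  shows "R t \<le> total R"
proof (cases "R t = 0")
  case False
  then show ?thesis
    unfolding total_def using assms by (intro member_le_sum) auto
qed simp

lemma total_mono:
  assumes "finite {t. R t \<noteq> 0}" "\<And>t. R' t \<le> R t"
  shows "total R' \<le> total R"
proof -
  have "R t \<noteq> 0" if "R' t \<noteq> 0" for t
    using that assms(2)[of t] by simp
  then have "total R' = (\<Sum>t | R t \<noteq> 0. R' t)"
    by (intro total_eq_sum assms) auto
  also have "\<dots> \<le> total R"
    unfolding total_def by (intro sum_mono assms)
  finally show ?thesis .
qed

lemma total_union:
  assumes "finite {t. R1 t \<noteq> 0}" "finite {t. R2 t \<noteq> 0}"
  shows "total (nrel_union R1 R2) = total R1 + total R2"
proof -
  let ?A = "{t. R1 t \<noteq> 0} \<union> {t. R2 t \<noteq> 0}"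
  have "total R1 = sum R1 ?A" "total R2 = sum R2 ?A"
    "total (nrel_union R1 R2) = sum (nrel_union R1 R2) ?A"
    by (rule total_eq_sum; use assms in \<open>auto simp: nrel_union_def\<close>)+
  then show ?thesis by (simp add: nrel_union_def sum.distrib)
qed

text \<open>Cutting a tuple at position \<open>m\<close> is injective, so the nonzero multiplicities
  of the product are distinct terms of the expanded product of totals. Only an inequality holds:
  \<open>m\<close> is arbitrary here, and a pair whose first component does not have length
  \<open>m\<close> need not arise from a cut.\<close>

lemma total_times_le:
  assumes "finite {t. R1 t \<noteq> 0}" "finite {t. R2 t \<noteq> 0}"
  shows "total (nrel_times m R1 R2) \<le> total R1 * total R2"
proof -
  let ?S = "{t. nrel_times m R1 R2 t \<noteq> 0}"
  let ?split = "\<lambda>t. (take m t, drop m t)"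
  let ?f = "\<lambda>(a, b). R1 a * R2 b"
  have "inj_on ?split ?S"
    by (rule inj_onI) (metis append_take_drop_id prod.inject)
  then have "total (nrel_times m R1 R2) = sum ?f (?split ` ?S)"
    by (simp add: total_def sum.reindex nrel_times_def)
  also have "\<dots> \<le> sum ?f ({t. R1 t \<noteq> 0} \<times> {t. R2 t \<noteq> 0})"
    using assms by (intro sum_mono2) (auto simp: nrel_times_def)
  also have "\<dots> = total R1 * total R2"
    by (simp add: total_def sum_product sum.cartesian_product)
  finally show ?thesis .
qed

text \<open>The fibres of the projection map partition the support of \<open>R\<close>, and each
  fibre sum is one multiplicity of the projection.\<close>

lemma total_proj:
  assumes "finite {t. R t \<noteq> 0}"
  shows "total (nrel_proj v R) = total R"
proof -
  let ?p = "\<lambda>w. map (\<lambda>i. w ! i) v"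
  have "\<exists>w. ?p w = t \<and> R w \<noteq> 0" if "nrel_proj v R t \<noteq> 0" for t
    using sum.not_neutral_contains_not_neutral[OF that[unfolded nrel_proj_def]] by blast
  then have "{t. nrel_proj v R t \<noteq> 0} \<subseteq> ?p ` {w. R w \<noteq> 0}"
    by fast
  then have "total (nrel_proj v R) = (\<Sum>t\<in>?p ` {w. R w \<noteq> 0}. nrel_proj v R t)"
    using assms by (intro total_eq_sum) auto
  also have "\<dots> = total R"
    \<comment> \<open>\<open>sum.image_gen\<close> regroups the total of \<open>R\<close> by fibres
      of \<open>?p\<close>.\<close>
    unfolding total_def sum.image_gen[OF assms, of R ?p]
    by (intro sum.cong refl) (auto simp: nrel_proj_def intro!: sum.cong)
  finally show ?thesis .
qed

text \<open>Induction on the expression. The exponent \<open>c\<close> is chosen before the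
  database, so it depends on the expression and the schema alone. A pure power of \<open>N\<close>
  suffices as the polynomial bound because \<open>2 \<le> N\<close> lets one extra factor
  \<open>N\<close> absorb the doubling caused by a union.\<close>

lemma total_eval_bra_bound:
  assumes "wf_bra \<tau> E"
  shows "\<exists>c. \<forall>(I :: 'd nrel list) N. is_database \<tau> I \<longrightarrow> 2 \<le> N \<longrightarrow> (\<forall>R\<in>set I. total R \<le> N) \<longrightarrow>
    total (eval_bra \<tau> I E) \<le> N ^ c" (is "?bounded E")
proof -
  \<comment> \<open>An operation that does not increase the total inherits the exponent of its
    argument; this covers projection, difference, selection and support.\<close>
  have bounded_mono: "?bounded F"
    if "?bounded E" "\<And>I :: 'd nrel list. is_database \<tau> I \<Longrightarrow>
      total (eval_bra \<tau> I F) \<le> total (eval_bra \<tau> I E)" for E F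
    using that by (meson order_trans)
  show ?thesis
    using assms
  proof (induction E)
    case (Rel i)
    then show ?case
      by (intro exI[of _ 1]) (auto simp: is_database_def list_all2_conv_all_nth)
  next
    case (Cup E F)
    then have wf: "wf_bra \<tau> E" "wf_bra \<tau> F" by simp_all
    obtain c where
      c: "\<And>(I :: 'd nrel list) N. is_database \<tau> I \<Longrightarrow> 2 \<le> N \<Longrightarrow> \<forall>R\<in>set I. total R \<le> N \<Longrightarrow>
        total (eval_bra \<tau> I E) \<le> N ^ c"
      using Cup.IH(1)[OF wf(1)] by blast
    obtain d where
      d: "\<And>(I :: 'd nrel list) N. is_database \<tau> I \<Longrightarrow> 2 \<le> N \<Longrightarrow> \<forall>R\<in>set I. total R \<le> N \<Longrightarrow>
        total (eval_bra \<tau> I F) \<le> N ^ d"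
      using Cup.IH(2)[OF wf(2)] by blast
    show ?case
    proof (intro exI allI impI)
      fix I :: "'d nrel list" and N :: nat
      assume I: "is_database \<tau> I" and N: "2 \<le> N" and bound: "\<forall>R\<in>set I. total R \<le> N"
      have fin: "finite {t. eval_bra \<tau> I E t \<noteq> 0}" "finite {t. eval_bra \<tau> I F t \<noteq> 0}"
        using is_nrel_finite[OF is_nrel_eval_bra[OF I]] wf by auto
      have "total (eval_bra \<tau> I (Cup E F)) \<le> N ^ c + N ^ d"
        using c[OF I N bound] d[OF I N bound] by (simp add: total_union[OF fin])
      \<comment> \<open>Both exponents are raised to their maximum, and then the factor 2 is bounded
        by \<open>N\<close>.\<close>
      also have "\<dots> \<le> N ^ max c d + N ^ max c d"
        using N by (intro add_mono power_increasing) auto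
      also have "\<dots> \<le> N ^ Suc (max c d)"
        using N by (simp flip: mult_2)
      finally show "total (eval_bra \<tau> I (Cup E F)) \<le> N ^ Suc (max c d)" .
    qed
  next
    case (Times E F)
    then have wf: "wf_bra \<tau> E" "wf_bra \<tau> F" by simp_all
    obtain c where
      c: "\<And>(I :: 'd nrel list) N. is_database \<tau> I \<Longrightarrow> 2 \<le> N \<Longrightarrow> \<forall>R\<in>set I. total R \<le> N \<Longrightarrow>
        total (eval_bra \<tau> I E) \<le> N ^ c"
      using Times.IH(1)[OF wf(1)] by blast
    obtain d where
      d: "\<And>(I :: 'd nrel list) N. is_database \<tau> I \<Longrightarrow> 2 \<le> N \<Longrightarrow> \<forall>R\<in>set I. total R \<le> N \<Longrightarrow>
        total (eval_bra \<tau> I F) \<le> N ^ d"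
      using Times.IH(2)[OF wf(2)] by blast
    show ?case
    proof (intro exI allI impI)
      fix I :: "'d nrel list" and N :: nat
      assume I: "is_database \<tau> I" and N: "2 \<le> N" and bound: "\<forall>R\<in>set I. total R \<le> N"
      have fin: "finite {t. eval_bra \<tau> I E t \<noteq> 0}" "finite {t. eval_bra \<tau> I F t \<noteq> 0}"
        using is_nrel_finite[OF is_nrel_eval_bra[OF I]] wf by auto
      have "total (eval_bra \<tau> I (Times E F)) \<le> total (eval_bra \<tau> I E) * total (eval_bra \<tau> I F)"
        by (simp add: total_times_le[OF fin])
      also have "\<dots> \<le> N ^ (c + d)"
        unfolding power_add by (intro mult_mono c d I N bound) auto
      finally show "total (eval_bra \<tau> I (Times E F)) \<le> N ^ (c + d)" .
    qed
  next
    case (Proj v E)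
    then have wf: "wf_bra \<tau> E" by simp
    show ?case
      using Proj.IH[OF wf]
    proof (rule bounded_mono)
      fix I :: "'d nrel list"
      assume "is_database \<tau> I"
      from is_nrel_finite[OF is_nrel_eval_bra[OF this wf]]
      show "total (eval_bra \<tau> I (Proj v E)) \<le> total (eval_bra \<tau> I E)"
        by (simp add: total_proj)
    qed
  next
    case (Diff E F)
    then have wf: "wf_bra \<tau> E" by simp
    show ?case
      using Diff.IH(1)[OF wf]
    proof (rule bounded_mono)
      fix I :: "'d nrel list"
      assume "is_database \<tau> I"
      from is_nrel_finite[OF is_nrel_eval_bra[OF this wf]]
      show "total (eval_bra \<tau> I (Diff E F)) \<le> total (eval_bra \<tau> I E)"
        by (auto intro!: total_mono simp: nrel_diff_def)
    qed
  next
    case (Sel \<theta> E)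
    then have wf: "wf_bra \<tau> E" by simp
    show ?case
      using Sel.IH[OF wf]
    proof (rule bounded_mono)
      fix I :: "'d nrel list"
      assume "is_database \<tau> I"
      from is_nrel_finite[OF is_nrel_eval_bra[OF this wf]]
      show "total (eval_bra \<tau> I (Sel \<theta> E)) \<le> total (eval_bra \<tau> I E)"
        by (auto intro!: total_mono simp: nrel_sel_def)
    qed
  next
    case (Supp E)
    then have wf: "wf_bra \<tau> E" by simp
    show ?case
      using Supp.IH[OF wf]
    proof (rule bounded_mono)
      fix I :: "'d nrel list"
      assume "is_database \<tau> I"
      from is_nrel_finite[OF is_nrel_eval_bra[OF this wf]]
      show "total (eval_bra \<tau> I (Supp E)) \<le> total (eval_bra \<tau> I E)"
        by (auto intro!: total_mono simp: nrel_supp_def bag_supp_def)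
    qed
  qed
qed

text \<open>Taking \<open>k\<close> to be a power of 2, namely \<open>2 ^ (2 * n)\<close> with
  \<open>n = c + 1\<close>, makes both sides powers of 2. It remains to compare exponents:
  \<open>(2 * n + 1) * c\<close> against \<open>2 ^ (2 * n)\<close>.\<close>

lemma exp_exceeds_power:
  fixes c :: nat
  shows "\<exists>k\<ge>1. (2 * k) ^ c < 2 ^ k"
proof -
  define n where "n = Suc c"
  have "2 * n \<le> 2 ^ n"
    using Suc_leI[OF less_exp[of c]] unfolding n_def power_Suc by simp
  then have "2 * n * (2 * n) \<le> 2 ^ n * 2 ^ n"
    by (intro mult_mono) auto
  then have "4 * n * n \<le> 2 ^ (2 * n)"
    by (simp add: power_mult power2_eq_square algebra_simps)
  \<comment> \<open>In terms of \<open>c\<close> the left side is \<open>2 * c * c + 3 * c\<close>,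
    which is below \<open>4 * n * n\<close>.\<close>
  then have "Suc (2 * n) * c < 2 ^ (2 * n)"
    by (simp add: n_def algebra_simps)
  then have "(2 * 2 ^ (2 * n)) ^ c < (2::nat) ^ 2 ^ (2 * n)"
    by (simp flip: power_Suc power_mult)
  then show ?thesis
    by (intro exI[of _ "2 ^ (2 * n)"]) simp
qed

theorem theorem2:
  assumes "countable (UNIV :: 'd set)" and "infinite (UNIV :: 'd set)"
  shows "\<exists>n1 n2 :: nat. n1 > n2 \<and> n2 \<ge> 1 \<and>
    \<not> (\<exists>E :: bra. wf_bra [n1, n2] E \<and> arity [n1, n2] E = n1 - n2 \<and>
      (\<forall>R S :: 'd nrel. is_database [n1, n2] [R, S] \<longrightarrow>
        eval_bra [n1, n2] [R, S] E = nrel_division n1 n2 R S))"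
\<comment> \<open>Arities 2 and 1 are the smallest that satisfy the constraints.\<close>
proof (rule exI[of _ 2], rule exI[of _ 1], intro conjI notI)
  assume "\<exists>E. wf_bra [2, 1] E \<and> arity [2, 1] E = 2 - 1 \<and>
    (\<forall>R S :: 'd nrel. is_database [2, 1] [R, S] \<longrightarrow>
      eval_bra [2, 1] [R, S] E = nrel_division 2 1 R S)"
  then obtain E where wf: "wf_bra [2, 1] E" and
    E: "\<And>R S :: 'd nrel. is_database [2, 1] [R, S] \<Longrightarrow>
      eval_bra [2, 1] [R, S] E = nrel_division 2 1 R S"
    by blast
  obtain c where c: "\<And>(I :: 'd nrel list) N. is_database [2, 1] I \<Longrightarrow> 2 \<le> N \<Longrightarrow>
      \<forall>R\<in>set I. total R \<le> N \<Longrightarrow> total (eval_bra [2, 1] I E) \<le> N ^ c"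
    using total_eval_bra_bound[OF wf] by blast
  obtain k where k: "k \<ge> 1" "(2 * k) ^ c < (2::nat) ^ k"
    using exp_exceeds_power by blast
  obtain B :: "'d set" where B: "finite B" "card B = k"
    using infinite_arbitrarily_large[OF assms(2)] by blast
  \<comment> \<open>The value \<open>a\<close> is the constant first column of \<open>R\<close>. It
    may also occur as a second entry, since \<open>[a, b]\<close> still determines
    \<open>b\<close>.\<close>
  then have "B \<noteq> {}" using k(1) by auto
  then obtain a where a: "a \<in> B" by blast
  define R :: "'d nrel" where "R = (\<lambda>t. if t \<in> (\<lambda>b. [a, b]) ` B then 2 else 0)"
  define S :: "'d nrel" where "S = (\<lambda>t. if t \<in> (\<lambda>b. [b]) ` B then 1 else 0)"
  have supp: "{t. R t \<noteq> 0} = (\<lambda>b. [a, b]) ` B" "{t. S t \<noteq> 0} = (\<lambda>b. [b]) ` B"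
    by (auto simp: R_def S_def)
  have db: "is_database [2, 1] [R, S]"
    using B a supp by (auto simp: is_database_def is_nrel_def R_def S_def)
  have "total R = 2 * k" "total S = k"
    unfolding total_def supp using B by (simp_all add: sum.reindex card_image inj_on_def R_def S_def)
  \<comment> \<open>The common bound on the totals is \<open>N = 2 * k\<close>, and
    \<open>k \<ge> 1\<close> gives \<open>2 \<le> N\<close>.\<close>
  then have "total (eval_bra [2, 1] [R, S] E) \<le> (2 * k) ^ c"
    using k(1) by (intro c db) auto
  moreover have "nrel_division 2 1 R S [a] = 2 ^ k"
  proof -
    have "{b. length b = 1 \<and> R ([a] @ b) \<noteq> 0} = (\<lambda>b. [b]) ` B"
      by (auto simp: R_def)
    moreover have "(\<Prod>b\<in>(\<lambda>b. [b]) ` B. R ([a] @ b)) = 2 ^ k"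
      using B by (simp add: prod.reindex inj_on_def R_def)
    moreover have "(\<Sum>b\<in>(\<lambda>b. [b]) ` B. R ([a] @ b)) = 2 * k"
      using B by (simp add: sum.reindex inj_on_def R_def)
    \<comment> \<open>Since \<open>k \<ge> 1\<close>, the sum \<open>2 * k\<close> is nonzero, so
      the support factor is 1 and only the product remains.\<close>
    ultimately show ?thesis
      using k(1) supp by (simp add: nrel_division_def bag_supp_def)
  qed
  \<comment> \<open>A single multiplicity never exceeds the total, so the bound on \<open>E\<close>
    would force \<open>2 ^ k \<le> (2 * k) ^ c\<close>.\<close>
  moreover have "nrel_division 2 1 R S [a] \<le> total (eval_bra [2, 1] [R, S] E)"
    unfolding E[OF db, symmetric]
    by (rule le_total[OF is_nrel_finite[OF is_nrel_eval_bra[OF db wf]]])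
  ultimately show False using k(2) by simp
qed simp_all

end
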